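(* Let $S$ be a semidomain. Then $S$ is a unique factorization semidomain if and only if every nonzero prime ideal of $S$ contains a prime element.
   Context: A semiring is a set $S$ with two operations $+$ and $\cdot$ such that $(S,+)$ is a commutative monoid with identity $0$, $(S,\cdot)$ is a commutative monoid with identity $1\neq 0$, multiplication distributes over addition, and $s\cdot 0=0$ for all $s\in S$. A semidomain is a semiring $S$ such that $ab=ac$ implies $b=c$ for all $b,c\in S$ and all nonzero $a\in S$. An ideal of $S$ is a nonempty subset $I$ with $a+b\in I$ and $sa\in I$ for all $a,b\in I$, $s\in S$; a proper ideal $P$ (i.e. $P\ne S$) is prime if $ab\in P$ implies $a\in P$ or $b\in P$. The principal ideal generated by $a$ is $(a)=\{sa: s\in S\}$. A unit is a multiplicatively invertible element. A nonzero nonunit $s\in S$ is irreducible if $s=s_1s_2$ with $s_1,s_2\in S$ implies that $s_1$ or $s_2$ is a unit. A prime element is a nonzero element $p\in S$ such that $(p)$ is a prime ideal. A semidomain $S$ is a unique factorization semidomain (UFSD) if (UF1) each irreducible element of $S$ is a prime element of $S$, and (UF2) every nonzero nonunit element of $S$ is a product of irreducible elements of $S$. *)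

theory Defs
  imports "HOL-Computational_Algebra.Factorial_Ring"
begin

text \<open>
  \<^class>\<open>comm_semiring_1\<close> supplies the commutative semiring axioms, including
  absorption by \<open>0\<close> and \<open>1 \<noteq> 0\<close>.
  The library class \<^class>\<open>semidom\<close> is not used, since it also
  requires cancellative addition.
\<close>
class semidomain = comm_semiring_1 +
  assumes semidomain_mult_left_cancel: "a \<noteq> 0 \<Longrightarrow> a * b = a * c \<Longrightarrow> b = c"

definition semiring_ideal :: "'a::comm_semiring_1 set \<Rightarrow> bool" where
  "semiring_ideal I \<longleftrightarrow>
     I \<noteq> {} \<and> (\<forall>a\<in>I. \<forall>b\<in>I. a + b \<in> I) \<and> (\<forall>s. \<forall>a\<in>I. s * a \<in> I)"

definition prime_ideal :: "'a::comm_semiring_1 set \<Rightarrow> bool" where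
  "prime_ideal P \<longleftrightarrow>
     semiring_ideal P \<and> P \<noteq> UNIV \<and> (\<forall>a b. a * b \<in> P \<longrightarrow> a \<in> P \<or> b \<in> P)"

definition principal_ideal :: "'a::comm_semiring_1 \<Rightarrow> 'a set" where
  "principal_ideal a = {s * a | s. True}"

definition prime_element :: "'a::comm_semiring_1 \<Rightarrow> bool" where
  "prime_element p \<longleftrightarrow> p \<noteq> 0 \<and> prime_ideal (principal_ideal p)"

text \<open>
  The units are the divisors of \<open>1\<close>. The factorization in the second clause is an exact
  equality (not merely up to a unit), and the multiset in it is nonempty because
  \<open>s\<close> is not a unit.
\<close>
definition ufsd :: "'a::semidomain itself \<Rightarrow> bool" where
  "ufsd _ \<longleftrightarrow>
     (\<forall>p::'a. irreducible p \<longrightarrow> prime_element p) \<and>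
     (\<forall>s::'a. s \<noteq> 0 \<longrightarrow> \<not> s dvd 1 \<longrightarrow>
        (\<exists>A. (\<forall>q\<in>#A. irreducible q) \<and> prod_mset A = s))"

lemma mem_principal_ideal_iff_dvd: "x \<in> principal_ideal a \<longleftrightarrow> a dvd x"
  by (auto simp: principal_ideal_def dvd_def mult.commute)

lemma semiring_ideal_principal_ideal: "semiring_ideal (principal_ideal a)"
  unfolding semiring_ideal_def
  by (metis mem_principal_ideal_iff_dvd dvd_add dvd_mult dvd_refl empty_iff)

lemma prime_element_iff_prime_elem: "prime_element p \<longleftrightarrow> prime_elem p"
proof -
  have "principal_ideal p = UNIV \<longleftrightarrow> p dvd 1"
    using mem_principal_ideal_iff_dvd[of _ p] dvd_trans[OF _ one_dvd, of p] by blast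
  thus ?thesis
    by (simp add: prime_element_def prime_ideal_def prime_elem_def
        semiring_ideal_principal_ideal mem_principal_ideal_iff_dvd)
qed

end

theory Submission imports Defs begin

text \<open>
  In the nontrivial direction (after Kaplansky), the nonzero elements that are a unit times a
  product of prime elements form a multiplicatively closed set that is closed under divisors. If a
  nonzero \<open>x\<close> were not in this set, the principal ideal of \<open>x\<close> would be disjoint from it, and an
  ideal that is maximal among those containing \<open>x\<close> and disjoint from the set would be a nonzero
  prime ideal without prime elements.
\<close>

section \<open>Ideals of a commutative semiring and prime ideals avoiding a multiplicative
  set\<close>

lemma semiring_ideal_mult: "semiring_ideal I \<Longrightarrow> a \<in> I \<Longrightarrow> s * a \<in> I"
  by (simp add: semiring_ideal_def)

lemma semiring_ideal_add: "semiring_ideal I \<Longrightarrow> a \<in> I \<Longrightarrow> b \<in> I \<Longrightarrow> a + b \<in> I"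
  by (simp add: semiring_ideal_def)

lemma semiring_ideal_zero: "semiring_ideal I \<Longrightarrow> 0 \<in> I"
  using semiring_ideal_mult[of I _ 0] by (auto simp: semiring_ideal_def)

lemma semiring_ideal_unit_eq_UNIV:
  assumes "semiring_ideal I" "u \<in> I" "u dvd 1"
  shows "I = UNIV"
proof -
  from assms(3) obtain v where v: "u * v = 1" by (metis dvdE)
  have "s \<in> I" for s
    using semiring_ideal_mult[OF assms(1,2), of "s * v"] v by (simp add: mult.assoc mult.commute[of v])
  thus ?thesis by blast
qed

text \<open>Any two elements of the union already lie in a common member of the chain. This provides
  the upper bounds for Zorn's lemma.\<close>

lemma semiring_ideal_Union_chain:
  assumes "C \<noteq> {}" "\<And>I. I \<in> C \<Longrightarrow> semiring_ideal I"
    and chain: "\<And>I J. I \<in> C \<Longrightarrow> J \<in> C \<Longrightarrow> I \<subseteq> J \<or> J \<subseteq> I"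
  shows "semiring_ideal (\<Union>C)"
  unfolding semiring_ideal_def
proof (intro conjI ballI allI)
  show "\<Union>C \<noteq> {}" using assms(1,2) semiring_ideal_zero by blast
  show "s * a \<in> \<Union>C" if "a \<in> \<Union>C" for s a
    using that assms(2) semiring_ideal_mult by blast
  show "a + b \<in> \<Union>C" if ab: "a \<in> \<Union>C" "b \<in> \<Union>C" for a b
  proof -
    obtain I J where "I \<in> C" "J \<in> C" "a \<in> I" "b \<in> J" using ab by blast
    with chain[of I J] obtain K where "K \<in> C" "a \<in> K" "b \<in> K" by blast
    thus ?thesis using assms(2) semiring_ideal_add by blast
  qed
qed

text \<open>This is the ideal sum \<open>I\<close> + (\<open>a\<close>), the smallest ideal
  containing \<open>I\<close> and \<open>a\<close> when \<open>I\<close> is an ideal.\<close>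

definition ideal_adjoin :: "'a::comm_semiring_1 set \<Rightarrow> 'a \<Rightarrow> 'a set" where
  "ideal_adjoin I a = {i + s * a | i s. i \<in> I}"

lemma semiring_ideal_ideal_adjoin:
  assumes "semiring_ideal I"
  shows "semiring_ideal (ideal_adjoin I a)"
  unfolding semiring_ideal_def
proof (intro conjI ballI allI)
  show "ideal_adjoin I a \<noteq> {}"
    using semiring_ideal_zero[OF assms] by (auto simp: ideal_adjoin_def)
next
  fix x y assume "x \<in> ideal_adjoin I a" "y \<in> ideal_adjoin I a"
  then obtain i s j t where ij: "i \<in> I" "j \<in> I" and "x = i + s * a" "y = j + t * a"
    unfolding ideal_adjoin_def by blast
  hence "x + y = (i + j) + (s + t) * a" by (simp add: algebra_simps)
  thus "x + y \<in> ideal_adjoin I a"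
    using semiring_ideal_add[OF assms ij] unfolding ideal_adjoin_def by blast
next
  fix r x assume "x \<in> ideal_adjoin I a"
  then obtain i s where i: "i \<in> I" and "x = i + s * a"
    unfolding ideal_adjoin_def by blast
  hence "r * x = r * i + (r * s) * a" by (simp add: algebra_simps)
  thus "r * x \<in> ideal_adjoin I a"
    using semiring_ideal_mult[OF assms i, of r] unfolding ideal_adjoin_def by blast
qed

lemma subset_ideal_adjoin: "I \<subseteq> ideal_adjoin I a"
proof
  fix i assume "i \<in> I"
  moreover have "i = i + 0 * a" by simp
  ultimately show "i \<in> ideal_adjoin I a" unfolding ideal_adjoin_def by blast
qed

lemma mem_ideal_adjoin:
  assumes "semiring_ideal I"
  shows "a \<in> ideal_adjoin I a"
proof -
  have "a = 0 + 1 * a" by simp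
  thus ?thesis using semiring_ideal_zero[OF assms] unfolding ideal_adjoin_def by blast
qed

text \<open>Every term in the expansion of (i + sa)(j + tb) has a factor in \<open>I\<close>, namely
  i, j or the product ab. This is what makes a maximal avoiding ideal prime.\<close>

lemma ideal_adjoin_mult:
  assumes "semiring_ideal I" "a * b \<in> I" "x \<in> ideal_adjoin I a" "y \<in> ideal_adjoin I b"
  shows "x * y \<in> I"
proof -
  obtain i s j t where ij: "i \<in> I" "j \<in> I" and xy: "x = i + s * a" "y = j + t * b"
    using assms(3,4) unfolding ideal_adjoin_def by blast
  note mult = semiring_ideal_mult[OF assms(1)]
  \<comment> \<open>The two terms of \<open>x * y\<close> that involve \<open>i\<close> are
    collected into \<open>y * i\<close>.\<close>
  have "y * i + ((s * a) * j + (s * t) * (a * b)) \<in> I"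
    by (intro semiring_ideal_add[OF assms(1)] mult[OF ij(1)] mult[OF ij(2)] mult[OF assms(2)])
  also have "y * i + ((s * a) * j + (s * t) * (a * b)) = x * y"
    by (simp add: xy algebra_simps)
  finally show ?thesis .
qed

text \<open>Zorn's lemma gives an ideal \<open>P\<close> maximal among those containing
  \<open>I\<close> and disjoint from \<open>T\<close>. If ab lay in \<open>P\<close> but neither a
  nor b did, both \<open>P\<close> + (a) and \<open>P\<close> + (b) would meet \<open>T\<close>; the
  product of the two witnesses would lie in \<open>P\<close> and in \<open>T\<close>.\<close>

lemma prime_ideal_avoiding_exists:
  fixes I T :: "'a::comm_semiring_1 set"
  assumes I: "semiring_ideal I" "I \<inter> T = {}"
    and T: "1 \<in> T" "\<And>x y. x \<in> T \<Longrightarrow> y \<in> T \<Longrightarrow> x * y \<in> T"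
  shows "\<exists>P. prime_ideal P \<and> I \<subseteq> P \<and> P \<inter> T = {}"
proof -
  define F where "F = {J. semiring_ideal J \<and> I \<subseteq> J \<and> J \<inter> T = {}}"
  have "\<exists>M\<in>F. \<forall>J\<in>F. M \<subseteq> J \<longrightarrow> J = M"
  proof (rule subset_Zorn_nonempty)
    show "F \<noteq> {}" using I unfolding F_def by blast
  next
    fix C assume C: "C \<noteq> {}" "subset.chain F C"
    hence F: "C \<subseteq> F" and chain: "\<And>J K. J \<in> C \<Longrightarrow> K \<in> C \<Longrightarrow> J \<subseteq> K \<or> K \<subseteq> J"
      by (auto simp: subset_chain_def)
    have "semiring_ideal (\<Union>C)"
      by (rule semiring_ideal_Union_chain) (use C F chain in \<open>auto simp: F_def\<close>)
    thus "\<Union>C \<in> F" using C(1) F unfolding F_def by blast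
  qed
  then obtain P where "P \<in> F" and max: "\<And>J. J \<in> F \<Longrightarrow> P \<subseteq> J \<Longrightarrow> J = P"
    by blast
  hence P: "semiring_ideal P" "I \<subseteq> P" "P \<inter> T = {}" by (simp_all add: F_def)
  have meets: "\<exists>x\<in>ideal_adjoin P a. x \<in> T" if "a \<notin> P" for a
  proof -
    have sub: "P \<subseteq> ideal_adjoin P a" by (rule subset_ideal_adjoin)
    \<comment> \<open>The enlarged ideal is strictly larger than \<open>P\<close>, so by maximality
      it is not in \<open>F\<close>; the only condition it can violate is disjointness from
      \<open>T\<close>.\<close>
    have "ideal_adjoin P a \<noteq> P" using mem_ideal_adjoin[OF P(1)] that by blast
    hence "ideal_adjoin P a \<notin> F" using max sub by blast
    thus ?thesis using semiring_ideal_ideal_adjoin[OF P(1), of a] P(2) sub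
      unfolding F_def by blast
  qed
  have "a \<in> P \<or> b \<in> P" if "a * b \<in> P" for a b
  proof (rule ccontr)
    assume "\<not> (a \<in> P \<or> b \<in> P)"
    hence "\<exists>x\<in>ideal_adjoin P a. x \<in> T" "\<exists>y\<in>ideal_adjoin P b. y \<in> T" by (simp_all add: meets)
    then obtain x y where "x \<in> ideal_adjoin P a" "y \<in> ideal_adjoin P b" "x \<in> T" "y \<in> T"
      by blast
    hence "x * y \<in> P" "x * y \<in> T" using ideal_adjoin_mult[OF P(1) that] T(2) by auto
    thus False using P(3) by blast
  qed
  moreover have "P \<noteq> UNIV" using P(3) T(1) by blast
  ultimately show ?thesis using P unfolding prime_ideal_def by blast
qed

section \<open>Prime elements under multiplicative cancellation\<close>

lemma semidomain_mult_eq_0_iff: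
  fixes a b :: "'a::semidomain"
  shows "a * b = 0 \<longleftrightarrow> a = 0 \<or> b = 0"
  using semidomain_mult_left_cancel[of a b 0] by auto

lemma semidomain_prime_elem_imp_irreducible:
  fixes p :: "'a::semidomain"
  assumes p: "prime_elem p"
  shows "irreducible p"
proof (rule irreducibleI)
  show p0: "p \<noteq> 0" and "\<not> p dvd 1" using p by (auto simp: prime_elem_def)
  \<comment> \<open>Writing \<open>a = p * c\<close> and cancelling \<open>p\<close> leaves
    \<open>c * b = 1\<close>. Primality of \<open>p\<close> puts one of the two factors in the
    position of \<open>a\<close>.\<close>
  have unit: "b dvd 1" if "p = a * b" "p dvd a" for a b
  proof -
    from that(2) obtain c where "a = p * c" by (elim dvdE)
    with that(1) have "p * 1 = p * (c * b)" by (simp add: ac_simps)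
    from semidomain_mult_left_cancel[OF p0 this] show ?thesis by (metis dvd_triv_right)
  qed
  fix a b assume ab: "p = a * b"
  hence "p dvd a * b" by simp
  hence "p dvd a \<or> p dvd b" using p unfolding prime_elem_def by blast
  thus "a dvd 1 \<or> b dvd 1"
    using unit[of a b] unit[of b a] ab by (auto simp: mult.commute)
qed

lemma prime_elem_mult_unit:
  fixes p u :: "'a::semidomain"
  assumes p: "prime_elem p" and u: "u dvd 1"
  shows "prime_elem (p * u)"
proof -
  from u obtain v where v: "u * v = 1" by (metis dvdE)
  have "(p * u) * v = p" using v by (simp add: mult.assoc)
  \<comment> \<open>\<open>p * u\<close> and \<open>p\<close> divide each other, hence divide the
    same elements, and primality is expressed through divisibility.\<close>
  hence *: "p * u dvd x \<longleftrightarrow> p dvd x" for x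
    by (metis dvd_triv_left dvd_trans)
  have "u \<noteq> 0" using v by auto
  thus ?thesis using p unfolding prime_elem_def * by (simp add: semidomain_mult_eq_0_iff)
qed

section \<open>Products of prime elements up to a unit\<close>

text \<open>The base case admits every unit, not just 1, so that the set can be closed under
  divisors.\<close>

inductive prime_factorable :: "'a::semidomain \<Rightarrow> bool" where
  unit: "u dvd 1 \<Longrightarrow> prime_factorable u"
| prime_mult: "prime_elem p \<Longrightarrow> prime_factorable x \<Longrightarrow> prime_factorable (p * x)"

lemma prime_factorable_nonzero: "prime_factorable x \<Longrightarrow> x \<noteq> 0"
  by (induction rule: prime_factorable.induct)
    (auto simp: semidomain_mult_eq_0_iff prime_elem_def)

lemma prime_factorable_prime_elem: "prime_elem p \<Longrightarrow> prime_factorable p"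
  using prime_factorable.prime_mult[of p 1] by (simp add: prime_factorable.unit)

lemma prime_factorable_unit_mult:
  assumes "prime_factorable x" "u dvd 1"
  shows "prime_factorable (u * x)"
  using assms
proof (induction rule: prime_factorable.induct)
  case (unit v)
  thus ?case using mult_dvd_mono[of u 1 v 1] by (simp add: prime_factorable.unit)
next
  case (prime_mult p x)
  thus ?case using prime_factorable.prime_mult[of p "u * x"] by (simp add: ac_simps)
qed

lemma prime_factorable_mult:
  assumes "prime_factorable x" "prime_factorable y"
  shows "prime_factorable (x * y)"
  using assms
  by (induction rule: prime_factorable.induct)
    (auto simp: mult.assoc intro: prime_factorable_unit_mult prime_factorable.prime_mult)

text \<open>Induction on the factorization of the product, for all ways of splitting it: the leading
  prime divides one of the two factors and can be cancelled there, which leaves a splitting of the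
  remaining product.\<close>

lemma prime_factorable_dvd:
  assumes "prime_factorable (a * b)"
  shows "prime_factorable a"
  using assms
proof (induction "a * b" arbitrary: a b rule: prime_factorable.induct)
  case unit
  thus ?case using dvd_mult_left prime_factorable.unit by blast
next
  case (prime_mult p x)
  have p0: "p \<noteq> 0" and "p dvd a \<or> p dvd b"
    using prime_mult.hyps(1,4) unfolding prime_elem_def by (blast, metis dvd_triv_left)
  thus ?case
  proof (elim disjE)
    assume "p dvd a"
    then obtain c where c: "a = p * c" by (elim dvdE)
    have "p * x = p * (c * b)" using prime_mult.hyps(4) c by (simp add: ac_simps)
    hence "prime_factorable c"
      using prime_mult.hyps(3) semidomain_mult_left_cancel[OF p0] by blast
    thus ?thesis using prime_mult.hyps(1) c prime_factorable.prime_mult by blast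
  next
    \<comment> \<open>Here \<open>a\<close> is untouched, so the induction hypothesis for the
      splitting \<open>x = a * c\<close> already concludes.\<close>
    assume "p dvd b"
    then obtain c where c: "b = p * c" by (elim dvdE)
    have "p * x = p * (a * c)" using prime_mult.hyps(4) c by (simp add: ac_simps)
    thus ?thesis
      using prime_mult.hyps(3) semidomain_mult_left_cancel[OF p0] by blast
  qed
qed

text \<open>The factorization has to be exact, so the unit is absorbed into the innermost prime;
  such a prime exists because \<open>x\<close> is not a unit.\<close>

lemma prime_factorable_imp_prod_mset:
  assumes "prime_factorable x" "\<not> x dvd 1"
  shows "\<exists>A. (\<forall>q\<in>#A. prime_elem q) \<and> prod_mset A = x"
  using assms
proof (induction rule: prime_factorable.induct)
  case (prime_mult p x)
  show ?case
  proof (cases "x dvd 1")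
    case True
    thus ?thesis
      using prime_elem_mult_unit[OF prime_mult.hyps(1)] by (intro exI[of _ "{#p * x#}"]) simp
  next
    case False
    then obtain A where "\<forall>q\<in>#A. prime_elem q" "prod_mset A = x"
      using prime_mult.IH by blast
    thus ?thesis using prime_mult.hyps(1) by (intro exI[of _ "add_mset p A"]) auto
  qed
qed simp

text \<open>An irreducible element is not a unit, so its factorization starts with a prime. By
  irreducibility the cofactor is a unit, and a unit multiple of a prime is prime.\<close>

lemma irreducible_prime_factorable_imp_prime_elem:
  assumes "prime_factorable x" "irreducible x"
  shows "prime_elem x"
  using assms(1)
proof cases
  case unit
  thus ?thesis using assms(2) by (simp add: irreducible_def)
next
  case (prime_mult p y)
  hence "y dvd 1" using assms(2) unfolding irreducible_def prime_elem_def by blast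
  thus ?thesis using prime_mult prime_elem_mult_unit by blast
qed

section \<open>Prime ideals and unique factorization\<close>

lemma prime_ideal_prod_mset:
  assumes P: "prime_ideal P" and "prod_mset A \<in> P"
  shows "\<exists>q\<in>#A. q \<in> P"
  using assms(2)
proof (induction A)
  case empty
  \<comment> \<open>The empty product is 1, which a proper ideal cannot contain.\<close>
  thus ?case using P semiring_ideal_unit_eq_UNIV[of P 1] by (simp add: prime_ideal_def)
next
  case (add q A)
  thus ?case using P by (auto simp: prime_ideal_def)
qed

theorem theorem4p7:
  "ufsd TYPE('a::semidomain) \<longleftrightarrow>
     (\<forall>P::'a set. prime_ideal P \<and> P \<noteq> {0} \<longrightarrow> (\<exists>p\<in>P. prime_element p))"
proof
  assume "ufsd TYPE('a)"
  hence prime: "\<And>p::'a. irreducible p \<Longrightarrow> prime_element p"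
    and factors: "\<And>s::'a. s \<noteq> 0 \<Longrightarrow> \<not> s dvd 1 \<Longrightarrow>
      \<exists>A. (\<forall>q\<in>#A. irreducible q) \<and> prod_mset A = s"
    by (simp_all add: ufsd_def)
  show "\<forall>P::'a set. prime_ideal P \<and> P \<noteq> {0} \<longrightarrow> (\<exists>p\<in>P. prime_element p)"
  proof (intro allI impI, elim conjE)
    fix P :: "'a set" assume P: "prime_ideal P" "P \<noteq> {0}"
    hence ideal: "semiring_ideal P" "P \<noteq> UNIV" by (auto simp: prime_ideal_def)
    \<comment> \<open>The irreducible factors of any nonzero element of \<open>P\<close> are prime,
      and \<open>P\<close> contains one of them.\<close>
    obtain s where s: "s \<in> P" "s \<noteq> 0" using P(2) semiring_ideal_zero[OF ideal(1)] by blast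
    have "\<not> s dvd 1" using semiring_ideal_unit_eq_UNIV[OF ideal(1) s(1)] ideal(2) by blast
    from factors[OF s(2) this] obtain A where A: "\<forall>q\<in>#A. irreducible q" "prod_mset A = s"
      by blast
    hence "prod_mset A \<in> P" using s(1) by simp
    from prime_ideal_prod_mset[OF P(1) this] obtain q where "q \<in># A" "q \<in> P" by blast
    thus "\<exists>p\<in>P. prime_element p" using A(1) prime by blast
  qed
next
  assume H: "\<forall>P::'a set. prime_ideal P \<and> P \<noteq> {0} \<longrightarrow> (\<exists>p\<in>P. prime_element p)"
  have factorable: "prime_factorable x" if "x \<noteq> 0" for x :: 'a
  proof (rule ccontr)
    assume x: "\<not> prime_factorable x"
    \<comment> \<open>Closure under divisors in contrapositive form: no multiple of \<open>x\<close>
      is factorable, so the principal ideal of \<open>x\<close> avoids the multiplicative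
      set.\<close>
    have "\<not> prime_factorable y" if "y \<in> principal_ideal x" for y
      using x that prime_factorable_dvd by (auto simp: mem_principal_ideal_iff_dvd dvd_def)
    hence "principal_ideal x \<inter> Collect prime_factorable = {}" by blast
    hence "\<exists>P. prime_ideal P \<and> principal_ideal x \<subseteq> P \<and> P \<inter> Collect prime_factorable = {}"
      by (intro prime_ideal_avoiding_exists semiring_ideal_principal_ideal)
        (simp_all add: prime_factorable.unit prime_factorable_mult)
    then obtain P where P: "prime_ideal P" "principal_ideal x \<subseteq> P"
        "P \<inter> Collect prime_factorable = {}"
      by blast
    \<comment> \<open>Since \<open>x\<close> is a nonzero member of \<open>P\<close>, the hypothesis
      applies to \<open>P\<close>. The prime element that it yields is itself factorable, against
      disjointness.\<close>
    have "x \<in> P" using P(2) mem_principal_ideal_iff_dvd[of x x] by auto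
    with \<open>x \<noteq> 0\<close> have "P \<noteq> {0}" by blast
    then obtain p where "p \<in> P" "prime_elem p"
      using H P(1) by (auto simp: prime_element_iff_prime_elem)
    thus False using P(3) prime_factorable_prime_elem by blast
  qed
  have "prime_element p" if "irreducible p" for p :: 'a
    using that factorable[of p] irreducible_prime_factorable_imp_prime_elem
    by (auto simp: prime_element_iff_prime_elem irreducible_def)
  moreover have "\<exists>A. (\<forall>q\<in>#A. irreducible q) \<and> prod_mset A = s"
    if "s \<noteq> 0" "\<not> s dvd 1" for s :: 'a
    using prime_factorable_imp_prod_mset[OF factorable[OF that(1)] that(2)]
      semidomain_prime_elem_imp_irreducible by blast
  ultimately show "ufsd TYPE('a)" by (simp add: ufsd_def)
qed

end
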